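(* Let $G$ be a finite simple graph containing an induced odd cycle $C_{2n+1}=(x_1,\ldots,x_{2n+1})$, $n\ge 1$. Then every Type-I minimum edge cover for $C_{2n+1}$ in $G$ has cardinality $n+1$, and every such cover consists of the $n$ edges of a maximum matching $M$ of $C_{2n+1}$ together with one of the two edges of $C_{2n+1}$ incident to the unique vertex of $C_{2n+1}$ not saturated by $M$.
   Context: Let $H$ be an induced subgraph of a finite simple graph $G$. An edge cover for $H$ in $G$ is a set $L\subseteq E(G)$ such that every vertex of $H$ is incident to some edge of $L$. It is a Type-I edge cover if $L\subseteq E(H)$. A Type-I minimum edge cover for $H$ in $G$ is a Type-I edge cover for $H$ in $G$ of smallest possible cardinality among all Type-I edge covers for $H$ in $G$. A vertex is saturated by a matching $M$ if it lies in some edge of $M$. *)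

theory Defs
  imports Main
begin

record 'a ugraph =
  verts :: "'a set"
  edges :: "'a set set"

definition finite_simple_graph :: "'a ugraph \<Rightarrow> bool" where
  "finite_simple_graph G \<longleftrightarrow>
     finite (verts G) \<and> (\<forall>e\<in>edges G. e \<subseteq> verts G \<and> card e = 2)"

definition induced_subgraph :: "'a ugraph \<Rightarrow> 'a ugraph \<Rightarrow> bool" where
  "induced_subgraph H G \<longleftrightarrow>
     verts H \<subseteq> verts G \<and> edges H = {e \<in> edges G. e \<subseteq> verts H}"

(* C is the cycle (x_1, ..., x_m); list positions start at 0, so x_i is xs ! (i - 1). *)
definition is_cycle :: "'a list \<Rightarrow> 'a ugraph \<Rightarrow> bool" where
  "is_cycle xs C \<longleftrightarrow>
     length xs \<ge> 3 \<and> distinct xs \<and> verts C = set xs \<and>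
     edges C = {{xs ! i, xs ! (Suc i mod length xs)} | i. i < length xs}"

definition edge_cover :: "'a ugraph \<Rightarrow> 'a ugraph \<Rightarrow> 'a set set \<Rightarrow> bool" where
  "edge_cover G H L \<longleftrightarrow> L \<subseteq> edges G \<and> (\<forall>v\<in>verts H. \<exists>e\<in>L. v \<in> e)"

definition type_I_edge_cover :: "'a ugraph \<Rightarrow> 'a ugraph \<Rightarrow> 'a set set \<Rightarrow> bool" where
  "type_I_edge_cover G H L \<longleftrightarrow> edge_cover G H L \<and> L \<subseteq> edges H"

definition type_I_minimum_edge_cover :: "'a ugraph \<Rightarrow> 'a ugraph \<Rightarrow> 'a set set \<Rightarrow> bool" where
  "type_I_minimum_edge_cover G H L \<longleftrightarrow>
     type_I_edge_cover G H L \<and> (\<forall>L'. type_I_edge_cover G H L' \<longrightarrow> card L \<le> card L')"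

definition matching :: "'a ugraph \<Rightarrow> 'a set set \<Rightarrow> bool" where
  "matching H M \<longleftrightarrow> M \<subseteq> edges H \<and> pairwise disjnt M"

definition maximum_matching :: "'a ugraph \<Rightarrow> 'a set set \<Rightarrow> bool" where
  "maximum_matching H M \<longleftrightarrow>
     matching H M \<and> (\<forall>M'. matching H M' \<longrightarrow> card M' \<le> card M)"

definition saturated :: "'a set set \<Rightarrow> 'a \<Rightarrow> bool" where
  "saturated M v \<longleftrightarrow> (\<exists>e\<in>M. v \<in> e)"

end

(* Counting incidences of vertices and edges, a cover of C_{2n+1} has at least n + 1 edges, and
   every other edge of the cycle together with the closing one attains this bound. In a minimum
   cover L the degrees sum to 2n + 2 over 2n + 1 vertices of degree at least 1, so exactly one
   vertex w has degree 2 and all others have degree 1. Removing an edge {u, w} of L leaves a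
   matching with n edges that misses only u. *)
theory Submission
  imports Defs
begin

lemma finite_cycle_edges:
  assumes "is_cycle xs C"
  shows "finite (edges C)"
  using assms by (simp add: is_cycle_def)

lemma induced_subgraph_finite_simple:
  assumes "finite_simple_graph G" "induced_subgraph H G"
  shows "finite_simple_graph H"
  using assms by (auto simp: finite_simple_graph_def induced_subgraph_def intro: finite_subset)

text \<open>Handshake count for an edge set \<open>L\<close>: both ends of each edge lie in
  \<open>verts G\<close>, so counting incident pairs by edges gives two per edge.\<close>

lemma sum_degrees_eq:
  assumes G: "finite_simple_graph G" and L: "L \<subseteq> edges G" "finite L"
  shows "(\<Sum>v\<in>verts G. card {e \<in> L. v \<in> e}) = 2 * card L"
proof -
  have "card {v \<in> verts G. v \<in> e} = 2" if "e \<in> L" for e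
  proof -
    have "{v \<in> verts G. v \<in> e} = e"
      using G L that by (auto simp: finite_simple_graph_def)
    then show ?thesis
      using G L that by (auto simp: finite_simple_graph_def)
  qed
  then show ?thesis
    using sum_multicount_gen[of "verts G" L "\<lambda>v e. v \<in> e" "\<lambda>_. 2"] G L
    by (simp add: finite_simple_graph_def)
qed

lemma card_cover_ge:
  assumes G: "finite_simple_graph G" and L: "L \<subseteq> edges G" "finite L"
    and cover: "\<forall>v\<in>verts G. \<exists>e\<in>L. v \<in> e"
  shows "card (verts G) \<le> 2 * card L"
proof -
  have "1 \<le> card {e \<in> L. v \<in> e}" if "v \<in> verts G" for v
    using that cover L(2) by (simp add: Suc_le_eq card_gt_0_iff) blast
  then have "(\<Sum>v\<in>verts G. 1) \<le> (\<Sum>v\<in>verts G. card {e \<in> L. v \<in> e})"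
    by (rule sum_mono)
  then show ?thesis
    using sum_degrees_eq[OF G L] by simp
qed

text \<open>Two distinct edges of a matching never meet, so every degree in \<open>M\<close> is at
  most 1 and the handshake count gives the bound. It serves to certify that a matching with
  \<open>n\<close> edges is maximum.\<close>

lemma card_matching_le:
  assumes G: "finite_simple_graph G" and M: "matching G M" and fin: "finite M"
  shows "2 * card M \<le> card (verts G)"
proof -
  have "card {e \<in> M. v \<in> e} \<le> Suc 0" for v
    using M fin by (subst card_le_Suc0_iff_eq) (auto simp: matching_def pairwise_def disjnt_iff)
  then have "(\<Sum>v\<in>verts G. card {e \<in> M. v \<in> e}) \<le> (\<Sum>v\<in>verts G. Suc 0)"
    by (intro sum_mono)
  then show ?thesis
    using sum_degrees_eq[OF G _ fin] M by (simp add: matching_def)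
qed

text \<open>Makes precise the phrase "one of the two edges" in the theorem: position
  \<open>k\<close> lies only on the edge starting at \<open>k\<close> and on the one starting at its
  cyclic predecessor.\<close>

lemma card_cycle_edges_at_vertex:
  assumes C: "is_cycle xs C" and u: "u \<in> verts C"
  shows "card {f \<in> edges C. u \<in> f} = 2"
proof -
  define m where "m = length xs"
  define E where "E i = {xs ! i, xs ! (Suc i mod m)}" for i
  have m: "m \<ge> 3" and dist: "distinct xs"
    and edges: "edges C = E ` {..<m}" and V: "verts C = set xs"
    using C by (auto simp: is_cycle_def m_def E_def)
  obtain k where k: "k < m" "u = xs ! k"
    using u V by (auto simp: in_set_conv_nth m_def)
  have nth_eq: "xs ! i = xs ! j \<longleftrightarrow> i = j" if "i < m" "j < m" for i j
    using that dist by (simp add: nth_eq_iff_index_eq m_def)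
  \<comment> \<open>Cyclic predecessor of \<open>k\<close>; the case \<open>k = 0\<close> is
    separate because \<open>0 - 1\<close> is \<open>0\<close> on the naturals.\<close>
  define p where "p = (if k = 0 then m - 1 else k - 1)"
  have p: "p < m" "p \<noteq> k"
    using k m by (auto simp: p_def)
  have mod_less: "Suc i mod m < m" for i
    using m by simp
  have "u \<in> E i \<longleftrightarrow> i = k \<or> i = p" if "i < m" for i
  proof -
    have "Suc i mod m = k \<longleftrightarrow> i = p"
      using that k m by (auto simp: p_def mod_Suc)
    then show ?thesis
      using that k mod_less nth_eq by (auto simp: E_def)
  qed
  then have "{f \<in> edges C. u \<in> f} = {E k, E p}"
    using edges k p by auto
  moreover have "E k \<noteq> E p"
  proof -
    \<comment> \<open>Predecessor and successor of \<open>k\<close> differ because the cycle has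
      length at least 3; for \<open>m = 2\<close> they would coincide.\<close>
    have "p \<noteq> Suc k mod m"
      using k m by (auto simp: p_def mod_Suc)
    then have "xs ! p \<notin> E k"
      using nth_eq[OF p(1) k(1)] nth_eq[OF p(1) mod_less] p by (simp add: E_def)
    then show ?thesis by (auto simp: E_def)
  qed
  ultimately show ?thesis by simp
qed

lemma odd_cycle_edge_cover:
  assumes C: "is_cycle xs C" and len: "length xs = 2 * n + 1"
  obtains L where "L \<subseteq> edges C" "\<forall>v\<in>verts C. \<exists>e\<in>L. v \<in> e" "card L \<le> n + 1"
proof
  define E where "E i = {xs ! i, xs ! (Suc i mod length xs)}" for i
  \<comment> \<open>The edge starting at position \<open>2 * j\<close> covers positions
    \<open>2 * j\<close> and \<open>2 * j + 1\<close>. For \<open>j = n\<close> it is the closing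
    edge, which covers the last position and, a second time, position 0.\<close>
  let ?L = "(\<lambda>j. E (2 * j)) ` {..n}"
  show "?L \<subseteq> edges C"
    using C len by (force simp: is_cycle_def E_def)
  show "card ?L \<le> n + 1"
    using card_image_le[of "{..n}" "\<lambda>j. E (2 * j)"] by simp
  show "\<forall>v\<in>verts C. \<exists>e\<in>?L. v \<in> e"
  proof
    fix v assume "v \<in> verts C"
    then obtain i where i: "i < 2 * n + 1" "v = xs ! i"
      using C len by (auto simp: is_cycle_def in_set_conv_nth)
    have "v \<in> E (2 * (i div 2))"
    proof (cases "even i")
      case True
      then show ?thesis using i by (simp add: E_def)
    next
      case False
      then have "Suc (2 * (i div 2)) = i"
        by simp
      then show ?thesis using i len by (simp add: E_def)
    qed
    moreover have "i div 2 \<in> {..n}" using i by auto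
    ultimately show "\<exists>e\<in>?L. v \<in> e" by blast
  qed
qed

text \<open>A pure degree count, valid in any finite simple graph: \<open>card\<close> says that the
  degrees in \<open>L\<close> exceed 1 by a total of exactly one.\<close>

lemma cover_one_excess_decompose:
  assumes G: "finite_simple_graph G" and L: "L \<subseteq> edges G" "finite L"
    and cover: "\<forall>v\<in>verts G. \<exists>e\<in>L. v \<in> e"
    and card: "2 * card L = card (verts G) + 1"
  obtains u e where "u \<in> verts G" "e \<in> L" "u \<in> e" "matching G (L - {e})"
    "{v \<in> verts G. \<not> saturated (L - {e}) v} = {u}"
proof -
  define d where "d v = card {e \<in> L. v \<in> e}" for v
  have finV: "finite (verts G)" and simple: "\<And>e. e \<in> L \<Longrightarrow> e \<subseteq> verts G \<and> card e = 2"
    using G L by (auto simp: finite_simple_graph_def)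
  have d_pos: "1 \<le> d v" if "v \<in> verts G" for v
    using that cover L(2) by (simp add: d_def Suc_le_eq card_gt_0_iff) blast
  \<comment> \<open>Subtraction on the naturals truncates; \<open>d_pos\<close> makes
    \<open>d v - 1\<close> the true excess at \<open>v\<close>. A sum of naturals equal to 1 then
    has a single nonzero term, at \<open>w\<close>.\<close>
  have "(\<Sum>v\<in>verts G. d v - 1) + (\<Sum>v\<in>verts G. 1) = (\<Sum>v\<in>verts G. d v)"
    unfolding sum.distrib[symmetric] using d_pos by (intro sum.cong refl le_add_diff_inverse2)
  then have "(\<Sum>v\<in>verts G. d v - 1) = 1"
    using sum_degrees_eq[OF G L] card by (simp add: d_def)
  then obtain w where w: "w \<in> verts G" "d w - 1 = 1"
    and others: "\<forall>v\<in>verts G. w \<noteq> v \<longrightarrow> d v - 1 = 0"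
    unfolding sum_eq_1_iff[OF finV] by blast
  obtain e where e: "e \<in> L" "w \<in> e"
    using cover w by blast
  obtain u where u: "e = {u, w}" "u \<noteq> w"
    using simple[OF e(1)] e(2) by (auto simp: card_2_iff)
  have uV: "u \<in> verts G"
    using simple[OF e(1)] u by auto
  define M where "M = L - {e}"
  have d_M: "card {f \<in> M. v \<in> f} = d v - (if v \<in> e then 1 else 0)" for v
  proof -
    have "{f \<in> M. v \<in> f} = {f \<in> L. v \<in> f} - (if v \<in> e then {e} else {})"
      by (auto simp: M_def)
    then show ?thesis
      using e L by (simp add: d_def card_Diff_singleton)
  qed
  \<comment> \<open>Removing \<open>e\<close> lowers the degree of \<open>w\<close> from 2 to 1 and
    that of \<open>u\<close> from 1 to 0; all other vertices keep degree 1.\<close>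
  have dM_eq: "card {f \<in> M. v \<in> f} = (if v = u then 0 else 1)" if "v \<in> verts G" for v
    using d_M[of v] d_pos[OF that] others that w(2) u by (auto split: if_splits)
  have finM: "finite M"
    using L by (simp add: M_def)
  have "matching G M"
    unfolding matching_def pairwise_def disjnt_iff
  proof (intro conjI ballI impI allI notI)
    show "M \<subseteq> edges G"
      using L by (auto simp: M_def)
    fix f g v assume fg: "f \<in> M" "g \<in> M" "f \<noteq> g" and v: "v \<in> f \<and> v \<in> g"
    then have "v \<in> verts G"
      using simple by (auto simp: M_def)
    then have "card {f \<in> M. v \<in> f} \<le> Suc 0"
      using dM_eq by simp
    with fg v finM show False
      by (subst (asm) card_le_Suc0_iff_eq) auto
  qed
  moreover have "{v \<in> verts G. \<not> saturated M v} = {u}"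
  proof -
    have "\<not> saturated M v \<longleftrightarrow> card {f \<in> M. v \<in> f} = 0" for v
      using finM by (auto simp: saturated_def)
    then show ?thesis
      using dM_eq uV by (auto split: if_splits)
  qed
  ultimately show thesis
    using that[of u e] uV e(1) u by (simp add: M_def)
qed

theorem mainTheorem8:
  fixes G C :: "'a ugraph" and xs :: "'a list" and n :: nat
  assumes "finite_simple_graph G"
    and "n \<ge> 1"
    and "is_cycle xs C"
    and "length xs = 2 * n + 1"
    and "induced_subgraph C G"
  shows "(\<forall>L. type_I_minimum_edge_cover G C L \<longrightarrow> card L = n + 1) \<and>
    (\<forall>L. type_I_minimum_edge_cover G C L \<longrightarrow>
      (\<exists>M u e. maximum_matching C M \<and> card M = n \<and>
        {v \<in> verts C. \<not> saturated M v} = {u} \<and>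
        card {f \<in> edges C. u \<in> f} = 2 \<and>
        e \<in> {f \<in> edges C. u \<in> f} \<and>
        L = insert e M))"
proof -
  note cyc = \<open>is_cycle xs C\<close>
  have C: "finite_simple_graph C"
    using assms induced_subgraph_finite_simple by blast
  have fin: "finite L" if "L \<subseteq> edges C" for L
    using that finite_cycle_edges[OF cyc] by (rule finite_subset)
  have cardV: "card (verts C) = 2 * n + 1"
    using assms by (auto simp: is_cycle_def distinct_card)
  \<comment> \<open>As \<open>edges C\<close> lies inside \<open>edges G\<close>, Type-I covers
    depend on \<open>C\<close> alone, and the rest of the argument takes place in
    \<open>C\<close>.\<close>
  have cover_iff: "type_I_edge_cover G C L \<longleftrightarrow> L \<subseteq> edges C \<and> (\<forall>v\<in>verts C. \<exists>e\<in>L. v \<in> e)" for L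
    using \<open>induced_subgraph C G\<close>
    by (auto simp: type_I_edge_cover_def edge_cover_def induced_subgraph_def)
  have card_L: "card L = n + 1" if L: "type_I_minimum_edge_cover G C L" for L
  proof (rule antisym)
    obtain L' where "type_I_edge_cover G C L'" "card L' \<le> n + 1"
      using odd_cycle_edge_cover[OF cyc \<open>length xs = 2 * n + 1\<close>] cover_iff by metis
    then show "card L \<le> n + 1"
      using L by (auto simp: type_I_minimum_edge_cover_def intro: le_trans)
    \<comment> \<open>Parity gives the last unit: \<open>2 * n + 1\<close> is at most the even
      number \<open>2 * card L\<close>.\<close>
    show "n + 1 \<le> card L"
      using card_cover_ge[OF C, of L] L fin cover_iff cardV
      by (simp add: type_I_minimum_edge_cover_def)
  qed
  have "\<exists>M u e. maximum_matching C M \<and> card M = n \<and>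
        {v \<in> verts C. \<not> saturated M v} = {u} \<and>
        card {f \<in> edges C. u \<in> f} = 2 \<and>
        e \<in> {f \<in> edges C. u \<in> f} \<and> L = insert e M"
    if min: "type_I_minimum_edge_cover G C L" for L
  proof -
    have L: "L \<subseteq> edges C" "\<forall>v\<in>verts C. \<exists>e\<in>L. v \<in> e"
      using min cover_iff by (auto simp: type_I_minimum_edge_cover_def)
    have "2 * card L = card (verts C) + 1"
      using card_L[OF min] cardV by simp
    from cover_one_excess_decompose[OF C L(1) fin[OF L(1)] L(2) this]
    obtain u e where ue: "u \<in> verts C" "e \<in> L" "u \<in> e" "matching C (L - {e})"
      "{v \<in> verts C. \<not> saturated (L - {e}) v} = {u}"
      .
    have card_M: "card (L - {e}) = n"
      using ue(2) card_L[OF min] by simp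
    \<comment> \<open>Parity again: the even number \<open>2 * card M'\<close> is at most
      \<open>2 * n + 1\<close>, hence at most \<open>2 * n\<close>.\<close>
    have "card M' \<le> n" if "matching C M'" for M'
      using card_matching_le[OF C that] that fin cardV by (simp add: matching_def)
    then have "maximum_matching C (L - {e})"
      using ue(4) card_M by (simp add: maximum_matching_def)
    moreover have "e \<in> {f \<in> edges C. u \<in> f}" "L = insert e (L - {e})"
      using ue L by auto
    ultimately show ?thesis
      using card_M ue(5) card_cycle_edges_at_vertex[OF cyc ue(1)] by blast
  qed
  with card_L show ?thesis by blast
qed

end
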